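(* Let $\mathcal{H}=\mathcal{H}_{\mathfrak l}\otimes\mathcal{H}_{\mathfrak w}\otimes\mathcal{H}_{\mathfrak e}$ be finite-dimensional with Hamiltonian $H_\kappa=H+\kappa\,\mathbb{1}_{\mathfrak l}\otimes H_u\otimes\mathbb{1}_{\mathfrak e}$, where $H_u$ is non-degenerate, and let the initial wall state $|\hat w\rangle$ be an eigenstate of $H_u$. Suppose there exists a choice of orthonormal bases $\{|j_{\mathfrak l}\rangle\}_{j_{\mathfrak l}=1}^{n_{\mathfrak l}}$ and $\{|j_{\mathfrak e}\rangle\}_{j_{\mathfrak e}=1}^{n_{\mathfrak e}}$ of $\mathcal{H}_{\mathfrak l}$ and $\mathcal{H}_{\mathfrak e}$, respectively, such that the asymptotic eigenstates $|\tilde\psi_j\rangle$ of $H_\kappa$ (those with wall factor $|\hat w\rangle$) can be written as product states of the form $|j_{\mathfrak l}\rangle|\hat w\rangle|j_{\mathfrak e}\rangle$. Then $\mathcal{C}_1\cap\mathcal{K}_1\cap\mathcal{K}_2=\varnothing$ if and only if $$\lambda_{[j_{\mathfrak l},\hat w,b_{\mathfrak e}]}-\lambda_{[i_{\mathfrak l},\hat w,b_{\mathfrak e}]}=\lambda_{[j_{\mathfrak l},\hat w,j_{\mathfrak e}]}-\lambda_{[i_{\mathfrak l},\hat w,j_{\mathfrak e}]}\qquad\text{for all } i_{\mathfrak l},j_{\mathfrak l},b_{\mathfrak e},j_{\mathfrak e},$$ where $\lambda_{[j_{\mathfrak l},\hat w,j_{\mathfrak e}]}$ denotes the eigenvalue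 of $H_\kappa$ corresponding to the asymptotic eigenstate $|j_{\mathfrak l}\rangle|\hat w\rangle|j_{\mathfrak e}\rangle$.
   Context: $H$ and $H_u$ are Hermitian; $n_{\mathfrak l}=\dim\mathcal{H}_{\mathfrak l}$, $n_{\mathfrak e}=\dim\mathcal{H}_{\mathfrak e}$. For each $\kappa$, let $|\psi_j^\kappa\rangle$ be an orthonormal eigenbasis of $H_\kappa$ with eigenvalues $\lambda_j^\kappa$, labelled and chosen so that the limits $|\tilde\psi_j\rangle=\lim_{\kappa\to\infty}|\psi_j^\kappa\rangle$ (asymptotic eigenstates) exist; each has the form $|\tilde\psi_j\rangle=\sum_{a,c}\alpha^{(j)}_{ac}|a\rangle|w_j\rangle|c\rangle$, where $\{|a\rangle\}$, $\{|c\rangle\}$ are orthonormal bases of $\mathcal{H}_{\mathfrak l}$, $\mathcal{H}_{\mathfrak e}$ and $|w_j\rangle$ is an eigenstate of $H_u$ (taken from a fixed orthonormal eigenbasis of $H_u$ containing $|\hat w\rangle$). The eigenvalue "corresponding to" the asymptotic eigenstate $|\tilde\psi_j\rangle$ is $\lambda_j^\kappa$. Define $\lambda_{abij}=\lambda_a^\kappa-\lambda_b^\kappa+\lambda_i^\kappa-\lambda_j^\kappa$ and $$\mathcal{C}_1=\{(a,b,i,j):\lambda_{abij}\ne0\},$$ $$\mathcal{K}_1=\{(a,b,i,j):|w_a\rangle=|w_b\rangle=|w_i\rangle=|w_j\rangle=|\hat w\rangle\},$$ $$\mathcal{K}_2=\{(a,b,i,j):(\langle\tilde\psi_b|\otimes\langle\tilde\psi_j|)\,\mathrm{SWAP}_{\mathfrak{ll}}\,(|\tilde\psi_a\rangle\otimes|\tilde\psi_i\rangle)\ne0\},$$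 where $\mathrm{SWAP}_{\mathfrak{ll}}(|a\rangle|b\rangle|c\rangle\otimes|i\rangle|j\rangle|k\rangle)=|i\rangle|b\rangle|c\rangle\otimes|a\rangle|j\rangle|k\rangle$ on $\mathcal{H}\otimes\mathcal{H}$. The set $\mathcal{C}_1$ and the eigenvalues depend on $\kappa$; the equivalence is understood at each fixed $\kappa$. *)

theory Defs
  imports "HOL-Analysis.Analysis"
begin

text \<open>Finite-dimensional Hilbert spaces are the coordinate spaces \<^typ>\<open>complex ^ 'n\<close>, so that
  \<open>CARD('n)\<close> is the dimension. The tensor product of \<open>complex ^ 'm\<close> and \<open>complex ^ 'n\<close>
  is \<open>complex ^ ('m \<times> 'n)\<close>; threefold products are nested to the right. The inner product is
  conjugate-linear in the first argument.\<close>

definition cinner :: "complex ^ 'n \<Rightarrow> complex ^ 'n \<Rightarrow> complex" where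
  "cinner x y = (\<Sum>i\<in>UNIV. cnj (x $ i) * y $ i)"

definition orthonormal_basis :: "('i \<Rightarrow> complex ^ 'n) \<Rightarrow> bool" where
  "orthonormal_basis b \<longleftrightarrow>
     (\<forall>i j. cinner (b i) (b j) = (if i = j then 1 else 0)) \<and> vec.span (range b) = UNIV"

definition hermitian :: "complex ^ 'n ^ 'n \<Rightarrow> bool" where
  "hermitian A \<longleftrightarrow> map_matrix cnj (transpose A) = A"

definition nondegenerate :: "complex ^ 'n ^ 'n \<Rightarrow> bool" where
  "nondegenerate A \<longleftrightarrow> (\<forall>\<mu>. vec.dim {v. A *v v = \<mu> *s v} \<le> 1)"

text \<open>The eigenvalues are taken real, the operators concerned being Hermitian.\<close>

definition orthonormal_eigenbasis ::
  "complex ^ 'n ^ 'n \<Rightarrow> ('i \<Rightarrow> complex ^ 'n) \<Rightarrow> ('i \<Rightarrow> real) \<Rightarrow> bool" where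
  "orthonormal_eigenbasis A v \<mu> \<longleftrightarrow>
     orthonormal_basis v \<and> (\<forall>j. A *v v j = complex_of_real (\<mu> j) *s v j)"

definition tensor :: "complex ^ 'm \<Rightarrow> complex ^ 'n \<Rightarrow> complex ^ ('m \<times> 'n)" (infixr "\<otimes>" 75) where
  "x \<otimes> y = (\<chi> p. x $ fst p * y $ snd p)"

definition op_tensor ::
  "complex ^ 'm ^ 'm \<Rightarrow> complex ^ 'n ^ 'n \<Rightarrow> complex ^ ('m \<times> 'n) ^ ('m \<times> 'n)"
    (infixr "\<otimes>\<^sub>o" 75) where
  "A \<otimes>\<^sub>o B = (\<chi> p q. A $ fst p $ fst q * B $ snd p $ snd q)"

lemma op_tensor_mult_tensor: "(A \<otimes>\<^sub>o B) *v (x \<otimes> y) = (A *v x) \<otimes> (B *v y)"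
  by (simp add: vec_eq_iff matrix_vector_mult_def op_tensor_def tensor_def sum_product
      sum.cartesian_product UNIV_Times_UNIV [symmetric] case_prod_unfold mult_ac
      del: UNIV_Times_UNIV)

definition H_coupled ::
  "complex ^ ('l::finite \<times> 'w::finite \<times> 'e::finite) ^ ('l \<times> 'w \<times> 'e) \<Rightarrow> complex ^ 'w ^ 'w \<Rightarrow> real
     \<Rightarrow> complex ^ ('l \<times> 'w \<times> 'e) ^ ('l \<times> 'w \<times> 'e)" where
  "H_coupled H Hu \<kappa> = H + \<kappa> *\<^sub>R (mat 1 \<otimes>\<^sub>o Hu \<otimes>\<^sub>o mat 1)"

definition swap_ll ::
  "complex ^ (('l::finite \<times> 'w::finite \<times> 'e::finite) \<times> ('l \<times> 'w \<times> 'e)) \<Rightarrow> complex ^ (('l \<times> 'w \<times> 'e) \<times> ('l \<times> 'w \<times> 'e))" where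
  "swap_ll v = (\<chi> p. case p of ((a, b, c), (i, j, k)) \<Rightarrow> v $ ((i, b, c), (a, j, k)))"

lemma swap_ll_tensor:
  "swap_ll ((a \<otimes> b \<otimes> c) \<otimes> (i \<otimes> j \<otimes> k)) = (i \<otimes> b \<otimes> c) \<otimes> (a \<otimes> j \<otimes> k)"
  by (simp add: vec_eq_iff swap_ll_def tensor_def split: prod.split)

text \<open>In the following, \<open>lam :: 'd \<Rightarrow> real\<close> lists the eigenvalues at one value of the coupling,
  \<open>\<psi>\<close> the asymptotic eigenstates and \<open>w\<close> their wall factors.\<close>

definition C1 :: "('d \<Rightarrow> real) \<Rightarrow> ('d \<times> 'd \<times> 'd \<times> 'd) set" where
  "C1 lam = {(a, b, i, j). lam a - lam b + lam i - lam j \<noteq> 0}"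

definition K1 :: "('d \<Rightarrow> complex ^ 'w) \<Rightarrow> complex ^ 'w \<Rightarrow> ('d \<times> 'd \<times> 'd \<times> 'd) set" where
  "K1 w w0 = {(a, b, i, j). w a = w0 \<and> w b = w0 \<and> w i = w0 \<and> w j = w0}"

definition K2 :: "('d \<Rightarrow> complex ^ ('l::finite \<times> 'w::finite \<times> 'e::finite)) \<Rightarrow> ('d \<times> 'd \<times> 'd \<times> 'd) set" where
  "K2 \<psi> = {(a, b, i, j). cinner (\<psi> b \<otimes> \<psi> j) (swap_ll (\<psi> a \<otimes> \<psi> i)) \<noteq> 0}"

text \<open>The eigenvalue belonging to the label whose asymptotic eigenstate is \<open>\<phi>\<close>. Limits of
  orthonormal families are orthonormal, so there is at most one such label.\<close>

definition eigenvalue_of :: "('d \<Rightarrow> real) \<Rightarrow> ('d \<Rightarrow> complex ^ 'n) \<Rightarrow> complex ^ 'n \<Rightarrow> real" where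
  "eigenvalue_of lam \<psi> \<phi> = lam (THE j. \<psi> j = \<phi>)"

end

theory Submission
  imports Defs
begin

text \<open>The expansion of a vector in the orthonormal basis \<open>\<psi> \<kappa>\<close> passes to the limit
  \<open>\<kappa> \<rightarrow> \<infinity>\<close>, so the asymptotic eigenstates are again orthonormal and complete.
  A product vector \<open>bl jl \<otimes> what \<otimes> be je\<close> that were not an asymptotic eigenstate would be
  orthogonal to all of them, by its wall factor or by one of the outer factors, hence zero.
  So the labels with wall factor \<open>what\<close> correspond bijectively to the pairs \<open>(jl, je)\<close>, and the
  \<open>swap_ll\<close> matrix element between such labels \<open>(a, b, i, j)\<close> is nonzero exactly if \<open>a\<close>, \<open>b\<close> share
  their right index, \<open>i\<close>, \<open>j\<close> share theirs, and the left indices satisfy \<open>a = j\<close>, \<open>b = i\<close>.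
  On these quadruples \<open>\<lambda>\<^sub>a - \<lambda>\<^sub>b + \<lambda>\<^sub>i - \<lambda>\<^sub>j = 0\<close> is the
  condition on gaps.\<close>

lemma cinner_tensor: "cinner (x \<otimes> y) (x' \<otimes> y') = cinner x x' * cinner y y'"
  by (simp add: cinner_def tensor_def sum_product sum.cartesian_product UNIV_Times_UNIV [symmetric]
      case_prod_unfold mult_ac del: UNIV_Times_UNIV)

lemma cinner_add_right: "cinner x (y + z) = cinner x y + cinner x z"
  by (simp add: cinner_def distrib_left sum.distrib)

lemma cinner_scale_right: "cinner x (c *s y) = c * cinner x y"
  by (simp add: cinner_def sum_distrib_left mult_ac)

lemma cinner_zero_right [simp]: "cinner x 0 = 0"
  by (simp add: cinner_def)

lemma cinner_sum_right: "cinner x (\<Sum>i\<in>A. f i) = (\<Sum>i\<in>A. cinner x (f i))"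
  by (induction A rule: infinite_finite_induct) (simp_all add: cinner_add_right)

lemma tendsto_cinner:
  assumes "(f \<longlongrightarrow> a) F" "(g \<longlongrightarrow> b) F"
  shows "((\<lambda>x. cinner (f x) (g x)) \<longlongrightarrow> cinner a b) F"
  unfolding cinner_def by (intro tendsto_intros assms)

lemma tendsto_scale:
  fixes g :: "'a \<Rightarrow> complex ^ 'n"
  assumes "(f \<longlongrightarrow> a) F" "(g \<longlongrightarrow> b) F"
  shows "((\<lambda>x. f x *s g x) \<longlongrightarrow> a *s b) F"
  unfolding vector_scalar_mult_def by (intro tendsto_intros assms)

lemma cinner_orthonormal_basis:
  "orthonormal_basis b \<Longrightarrow> cinner (b i) (b j) = (if i = j then 1 else 0)"
  by (simp add: orthonormal_basis_def)

text \<open>Both sides are linear in \<open>v\<close>, so induction over the span reduces the claim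
  to one basis vector, where orthonormality leaves a single term.\<close>

lemma orthonormal_basis_expansion:
  fixes b :: "'i::finite \<Rightarrow> complex ^ 'n"
  assumes "orthonormal_basis b"
  shows "(\<Sum>i\<in>UNIV. cinner (b i) v *s b i) = v"
proof -
  have "v \<in> vec.span (range b)"
    using assms by (simp add: orthonormal_basis_def)
  then show ?thesis
  proof (induction rule: vec.span_induct_alt)
    case base
    show ?case by simp
  next
    case (step c x y)
    then obtain k where x: "x = b k" by auto
    have "(\<Sum>i\<in>UNIV. cinner (b i) (b k) *s b i) = (\<Sum>i\<in>UNIV. if i = k then b i else 0)"
      by (rule sum.cong) (simp_all add: cinner_orthonormal_basis [OF assms])
    then have "(\<Sum>i\<in>UNIV. cinner (b i) x *s b i) = x"
      by (simp add: x)
    then have "c *s x + y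
        = c *s (\<Sum>i\<in>UNIV. cinner (b i) x *s b i) + (\<Sum>i\<in>UNIV. cinner (b i) y *s b i)"
      using step by simp
    also have "\<dots> = (\<Sum>i\<in>UNIV. cinner (b i) (c *s x + y) *s b i)"
      by (simp add: cinner_add_right cinner_scale_right vec.scale_sum_right vec.scale_left_distrib
          sum.distrib)
    finally show ?case by simp
  qed
qed

text \<open>The inner product is continuous and its values on the family do not depend on \<kappa>;
  \<open>F \<noteq> bot\<close> makes the limit unique.\<close>

lemma limit_orthonormal_family:
  assumes "\<And>\<kappa>. orthonormal_basis (\<psi> \<kappa>)" "\<And>j. ((\<lambda>\<kappa>. \<psi> \<kappa> j) \<longlongrightarrow> \<phi> j) F" "F \<noteq> bot"
  shows "cinner (\<phi> i) (\<phi> j) = (if i = j then 1 else 0)"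
  using tendsto_unique [OF assms(3) tendsto_cinner [OF assms(2,2)] ] assms(1)
  by (simp add: cinner_orthonormal_basis)

text \<open>Completeness is phrased as an identity because that form survives limits: the finite sum
  is continuous in the basis vectors and equals \<open>v\<close> for every \<kappa>.\<close>

lemma limit_orthonormal_family_expansion:
  fixes \<psi> :: "'a \<Rightarrow> 'd::finite \<Rightarrow> complex ^ 'n"
  assumes "\<And>\<kappa>. orthonormal_basis (\<psi> \<kappa>)" "\<And>j. ((\<lambda>\<kappa>. \<psi> \<kappa> j) \<longlongrightarrow> \<phi> j) F" "F \<noteq> bot"
  shows "(\<Sum>j\<in>UNIV. cinner (\<phi> j) v *s \<phi> j) = v"
proof (rule tendsto_unique [OF assms(3)])
  show "((\<lambda>\<kappa>. \<Sum>j\<in>UNIV. cinner (\<psi> \<kappa> j) v *s \<psi> \<kappa> j)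
      \<longlongrightarrow> (\<Sum>j\<in>UNIV. cinner (\<phi> j) v *s \<phi> j)) F"
    by (intro tendsto_sum tendsto_scale tendsto_cinner tendsto_const assms(2))
  show "((\<lambda>\<kappa>. \<Sum>j\<in>UNIV. cinner (\<psi> \<kappa> j) v *s \<psi> \<kappa> j) \<longlongrightarrow> v) F"
    by (simp add: orthonormal_basis_expansion [OF assms(1)])
qed

text \<open>Only the left factors move, so the matrix element splits into six inner products: two
  wall factors equal to 1 and four Kronecker deltas.\<close>

lemma cinner_swap_ll_product:
  assumes "orthonormal_basis p" "orthonormal_basis q" "cinner x x = 1"
  shows "cinner ((p b \<otimes> x \<otimes> q b') \<otimes> (p j \<otimes> x \<otimes> q j'))
      (swap_ll ((p a \<otimes> x \<otimes> q a') \<otimes> (p i \<otimes> x \<otimes> q i'))) \<noteq> 0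
    \<longleftrightarrow> b = i \<and> b' = a' \<and> j = a \<and> j' = i'"
  using assms by (simp add: swap_ll_tensor cinner_tensor cinner_orthonormal_basis)

theorem corollary1:
  fixes H :: "complex ^ ('l::finite \<times> 'w::finite \<times> 'e::finite) ^ ('l \<times> 'w \<times> 'e)"
    and Hu :: "complex ^ 'w ^ 'w"
    and u :: "'w \<Rightarrow> complex ^ 'w"
    and \<mu> :: "'w \<Rightarrow> real"
    and what :: "complex ^ 'w"
    and \<psi> :: "real \<Rightarrow> 'd::finite \<Rightarrow> complex ^ ('l \<times> 'w \<times> 'e)"
    and lam :: "real \<Rightarrow> 'd \<Rightarrow> real"
    and \<psi>t :: "'d \<Rightarrow> complex ^ ('l \<times> 'w \<times> 'e)"
    and fl :: "'l \<Rightarrow> complex ^ 'l"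
    and fe :: "'e \<Rightarrow> complex ^ 'e"
    and \<alpha> :: "'d \<Rightarrow> 'l \<Rightarrow> 'e \<Rightarrow> complex"
    and w :: "'d \<Rightarrow> complex ^ 'w"
    and bl :: "'l \<Rightarrow> complex ^ 'l"
    and be :: "'e \<Rightarrow> complex ^ 'e"
  assumes "hermitian H"
    and "hermitian Hu"
    and "nondegenerate Hu"
    and "orthonormal_eigenbasis Hu u \<mu>"
    and "what \<in> range u"
    and "\<And>\<kappa>. orthonormal_eigenbasis (H_coupled H Hu \<kappa>) (\<psi> \<kappa>) (lam \<kappa>)"
    and "\<And>j. ((\<lambda>\<kappa>. \<psi> \<kappa> j) \<longlongrightarrow> \<psi>t j) at_top"
    and "orthonormal_basis fl"
    and "orthonormal_basis fe"
    and "\<And>j. w j \<in> range u"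
    and "\<And>j. \<psi>t j = (\<Sum>a\<in>UNIV. \<Sum>c\<in>UNIV. \<alpha> j a c *s (fl a \<otimes> w j \<otimes> fe c))"
    and "orthonormal_basis bl"
    and "orthonormal_basis be"
    and "\<And>j. w j = what \<Longrightarrow> \<exists>jl je. \<psi>t j = bl jl \<otimes> what \<otimes> be je"
  shows "\<forall>\<kappa>. C1 (lam \<kappa>) \<inter> K1 w what \<inter> K2 \<psi>t = {} \<longleftrightarrow>
    (\<forall>il jl ce je.
       eigenvalue_of (lam \<kappa>) \<psi>t (bl jl \<otimes> what \<otimes> be ce)
         - eigenvalue_of (lam \<kappa>) \<psi>t (bl il \<otimes> what \<otimes> be ce)
       = eigenvalue_of (lam \<kappa>) \<psi>t (bl jl \<otimes> what \<otimes> be je)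
         - eigenvalue_of (lam \<kappa>) \<psi>t (bl il \<otimes> what \<otimes> be je))"
proof -
  note on = assms(6) [unfolded orthonormal_eigenbasis_def, THEN conjunct1]
  note \<psi>t_inner = limit_orthonormal_family [OF on assms(7) trivial_limit_at_top_linorder]
  note \<psi>t_expansion =
    limit_orthonormal_family_expansion [OF on assms(7) trivial_limit_at_top_linorder]
  have u: "orthonormal_basis u"
    using assms(4) by (simp add: orthonormal_eigenbasis_def)
  have what1: "cinner what what = 1"
    using assms(5) cinner_orthonormal_basis [OF u] by auto
  \<comment> \<open>Distinct members of \<open>range u\<close> are orthogonal, so each term of the
    expansion of \<open>\<psi>t j\<close> carries the factor
    \<open>cinner what (w j) = 0\<close>.\<close>
  have orth: "cinner (x \<otimes> what \<otimes> z) (\<psi>t j) = 0" if "w j \<noteq> what" for x z j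
  proof -
    have "cinner what (w j) = 0"
      using that assms(5) assms(10) [of j] cinner_orthonormal_basis [OF u] by auto
    then show ?thesis
      by (subst assms(11)) (simp add: cinner_sum_right cinner_scale_right cinner_tensor)
  qed
  have orth': "cinner (\<psi>t j) (x \<otimes> what \<otimes> z) = 0" if "w j \<noteq> what" for x z j
  proof -
    have "cinner (\<psi>t j) (x \<otimes> what \<otimes> z) = cnj (cinner (x \<otimes> what \<otimes> z) (\<psi>t j))"
      by (simp add: cinner_def mult.commute)
    then show ?thesis
      by (simp add: orth that)
  qed
  define P where "P jl je = bl jl \<otimes> what \<otimes> be je" for jl je
  have P_inner: "cinner (P a b) (P c d) = (if a = c \<and> b = d then 1 else 0)" for a b c d
    by (simp add: P_def cinner_tensor what1 cinner_orthonormal_basis assms(12,13))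
  have P_ex: "\<exists>j. \<psi>t j = P jl je" for jl je
  proof (rule ccontr)
    assume neq: "\<nexists>j. \<psi>t j = P jl je"
    have "cinner (\<psi>t j) (P jl je) = 0" for j
    proof (cases "w j = what")
      case True
      \<comment> \<open>By \<open>neq\<close> the pair \<open>(a, b)\<close> differs from
        \<open>(jl, je)\<close>, so the two products are orthogonal.\<close>
      then obtain a b where "\<psi>t j = P a b"
        using assms(14) [of j] unfolding P_def by auto
      then show ?thesis
        using neq P_inner by metis
    qed (simp add: P_def orth')
    then have "P jl je = 0"
      using \<psi>t_expansion [of "P jl je"] by simp
    then show False
      using P_inner [of jl je jl je] by simp
  qed
  then obtain L where L: "\<And>jl je. \<psi>t (L jl je) = P jl je"
    by metis
  have \<psi>t_inj: "i = j" if "\<psi>t i = \<psi>t j" for i j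
    using \<psi>t_inner [of i j] \<psi>t_inner [of j j] that by (auto split: if_splits)
  \<comment> \<open>Injectivity of \<open>\<psi>t\<close> makes \<open>L jl je\<close> the only
    label that \<open>THE\<close> can pick.\<close>
  have ev: "eigenvalue_of lm \<psi>t (bl jl \<otimes> what \<otimes> be je) = lm (L jl je)" for lm jl je
    unfolding eigenvalue_of_def P_def [symmetric] L [symmetric]
    by (rule arg_cong [where f = lm], rule the_equality) (auto intro: \<psi>t_inj)
  have w_iff: "w j = what \<longleftrightarrow> (\<exists>jl je. j = L jl je)" for j
  proof
    assume "w j = what"
    then obtain jl je where "\<psi>t j = P jl je"
      using assms(14) [of j] unfolding P_def by auto
    then show "\<exists>jl je. j = L jl je"
      using L \<psi>t_inj by metis
  next
    assume "\<exists>jl je. j = L jl je"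
    then obtain jl je where j: "\<psi>t j = P jl je"
      using L by blast
    show "w j = what"
    \<comment> \<open>The wall factor \<open>w j\<close> is given separately from
      \<open>\<psi>t j\<close>; if it differed from \<open>what\<close>, the unit vector
      \<open>P jl je\<close> would be orthogonal to itself.\<close>
    proof (rule ccontr)
      assume "w j \<noteq> what"
      then have "cinner (P jl je) (P jl je) = 0"
        using orth [of j "bl jl" "be je"] by (simp add: j P_def)
      then show False
        by (simp add: P_inner)
    qed
  qed
  have K2: "(L a a', L b b', L i i', L j j') \<in> K2 \<psi>t \<longleftrightarrow> b = i \<and> b' = a' \<and> j = a \<and> j' = i'"
    for a a' b b' i i' j j'
    using cinner_swap_ll_product [OF assms(12,13) what1]
    by (simp add: K2_def L P_def)
  \<comment> \<open>The four index equations leave two left indices \<open>a\<close>,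
    \<open>i\<close> and two right indices \<open>c\<close>, \<open>d\<close> free.\<close>
  have K12: "K1 w what \<inter> K2 \<psi>t = {(L a c, L i c, L i d, L a d) | a i c d. True}"
  proof (intro set_eqI iffI)
    fix q
    assume q: "q \<in> K1 w what \<inter> K2 \<psi>t"
    then obtain a a' b b' i i' j j' where abij: "q = (L a a', L b b', L i i', L j j')"
      unfolding K1_def w_iff by blast
    moreover have "b = i \<and> b' = a' \<and> j = a \<and> j' = i'"
      using q K2 by (simp add: abij)
    ultimately show "q \<in> {(L a c, L i c, L i d, L a d) | a i c d. True}"
      by blast
  next
    fix q
    assume "q \<in> {(L a c, L i c, L i d, L a d) | a i c d. True}"
    then obtain a i c d where "q = (L a c, L i c, L i d, L a d)"
      by blast
    moreover have "w (L x y) = what" for x y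
      unfolding w_iff by blast
    ultimately show "q \<in> K1 w what \<inter> K2 \<psi>t"
      using K2 by (simp add: K1_def)
  qed
  show ?thesis
  proof
    fix \<kappa>
    have "C1 (lam \<kappa>) \<inter> K1 w what \<inter> K2 \<psi>t = {}
        \<longleftrightarrow> (\<forall>i a c d. (L a c, L i c, L i d, L a d) \<notin> C1 (lam \<kappa>))"
      unfolding Int_assoc K12 by blast
    \<comment> \<open>Here \<open>i\<close>, \<open>a\<close>, \<open>c\<close>, \<open>d\<close>
      play the roles of \<open>il\<close>, \<open>jl\<close>, \<open>ce\<close>, \<open>je\<close>;
      moving the last two eigenvalues to the right turns the vanishing sum into equal gaps.\<close>
    also have "\<dots> \<longleftrightarrow> (\<forall>i a c d.
        lam \<kappa> (L a c) - lam \<kappa> (L i c) = lam \<kappa> (L a d) - lam \<kappa> (L i d))"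
      by (intro iff_allI) (auto simp: C1_def)
    finally show "C1 (lam \<kappa>) \<inter> K1 w what \<inter> K2 \<psi>t = {} \<longleftrightarrow>
      (\<forall>il jl ce je.
        eigenvalue_of (lam \<kappa>) \<psi>t (bl jl \<otimes> what \<otimes> be ce)
          - eigenvalue_of (lam \<kappa>) \<psi>t (bl il \<otimes> what \<otimes> be ce)
        = eigenvalue_of (lam \<kappa>) \<psi>t (bl jl \<otimes> what \<otimes> be je)
          - eigenvalue_of (lam \<kappa>) \<psi>t (bl il \<otimes> what \<otimes> be je))"
      unfolding ev .
  qed
qed

end
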